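(* Let $X$ be a real Hilbert space, $\varphi\in C^{2}(X,\mathbb{R})$, $c\in\mathbb{R}$ and $\varepsilon>0$. Assume that $\|\varphi'(u)\|\geq 2\varepsilon$ for every $u\in\varphi^{-1}([c-2\varepsilon,c+2\varepsilon])$. Let $D\subseteq\varphi^{-1}([c-0.5\varepsilon,c+0.5\varepsilon])$ be a subset. Then there exists a continuous map $\eta\in C(X,X)$ such that: (a') $\eta(u)=u$ for every $u\notin\varphi^{-1}([c-2\varepsilon,c+2\varepsilon])\setminus D$; (b') $\eta\big(\varphi^{-1}([c-\varepsilon,c-0.6\varepsilon])\big)\subset\varphi^{-1}\big([c+\varepsilon,+\infty)\big)$; (c') $\eta\big(\varphi^{-1}([c+0.6\varepsilon,c+\varepsilon])\big)\subset\varphi^{-1}\big((-\infty,c-\varepsilon]\big)$.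
   Context: $C(X,X)$ denotes the set of continuous maps from $X$ to $X$. $\varphi'(u)$ is the Fréchet derivative of $\varphi$ at $u$, an element of the dual of $X$, and $\|\varphi'(u)\|$ is its dual norm. *)

theory Defs
  imports "HOL-Analysis.Analysis"
begin

text \<open>The Frechet derivative as an element of the normed space of bounded linear maps.
  For a real-valued \<open>f\<close> this space is the dual, and \<open>norm\<close> is the dual norm.
  Where \<open>f\<close> is not differentiable the value is meaningless.\<close>

definition fderiv ::
  "('a::real_normed_vector \<Rightarrow> 'b::real_normed_vector) \<Rightarrow> 'a \<Rightarrow> 'a \<Rightarrow>\<^sub>L 'b" where
  "fderiv f u = Blinfun (frechet_derivative f (at u))"

text \<open>Continuity of \<open>f\<close> and of \<open>fderiv f\<close> is implied by their differentiability.
  The second derivative is continuous for the operator norm.\<close>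

definition C2 :: "('a::real_normed_vector \<Rightarrow> 'b::real_normed_vector) \<Rightarrow> bool" where
  "C2 f \<longleftrightarrow>
     f differentiable_on UNIV \<and>
     fderiv f differentiable_on UNIV \<and>
     continuous_on UNIV (fderiv (fderiv f))"

lemma fderiv_has_derivative:
  assumes "f differentiable (at u)"
  shows "(f has_derivative blinfun_apply (fderiv f u)) (at u)"
proof -
  have d: "(f has_derivative frechet_derivative f (at u)) (at u)"
    using assms by (simp add: frechet_derivative_works)
  then show ?thesis
    by (simp add: fderiv_def bounded_linear_Blinfun_apply has_derivative_bounded_linear)
qed

lemma fderiv_eqI:
  assumes "(f has_derivative blinfun_apply L) (at u)"
  shows "fderiv f u = L"
  by (metis assms blinfun_apply_inverse fderiv_def frechet_derivative_at)

end

theory Submission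
  imports Defs
begin

text \<open>
  The band of values between \<open>c - 2 * \<epsilon>\<close> and \<open>c + 2 * \<epsilon>\<close> contains no critical point, and the
  gradient there is bounded away from \<open>0\<close>, so points of the band can be pushed uphill or downhill.
  The classical tool for this is the flow of a gradient-like vector field.  Here no differential
  equation is solved: a continuous map \<open>\<eta>\<close> is wanted, not a deformation, and it can be obtained
  from finitely many discrete steps along the gradient.

  Let \<open>V\<close> be the gradient of \<open>\<phi>\<close>.  One uphill step is \<open>T u = u + w u\<close>, where \<open>w u\<close> is a small multiple
  of \<open>V u\<close>, depending continuously on \<open>u\<close>, such that along the whole segment from \<open>u\<close> to \<open>T u\<close> the
  function grows at no less than half the rate \<open>norm (V u)\<close> (\<open>ascent_step_field\<close>).  Where
  \<open>norm (V u) \<ge> 2 * \<epsilon>\<close>, the length of a step is therefore bounded by a constant times the gain in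
  \<open>\<phi>\<close>.  An orbit of \<open>T\<close> that stayed in the band for ever would have finite length and, the space
  being complete, would converge to a fixed point of \<open>T\<close>, hence to a zero of \<open>V\<close>, which is
  impossible.  So every orbit rises above the band after finitely many steps
  (\<open>orbit_leaves_band\<close>).

  The number of steps needed jumps from point to point, but it has a continuous upper bound \<open>n\<close>
  (\<open>continuous_index_bound\<close>), and one can continuously make a real number of steps by scaling the
  last one (\<open>variable_number_of_steps\<close>).  Making \<open>\<kappa> u * n u\<close> steps, with a continuous cut-off \<open>\<kappa>\<close>,
  moves the points with \<open>\<kappa> u = 1\<close> above the band and fixes those with \<open>\<kappa> u = 0\<close>.

  Taking for \<open>\<kappa>\<close> a function of \<open>\<phi>\<close> gives a map that lifts the values between \<open>c - \<epsilon>\<close> and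
  \<open>c - 0.6 * \<epsilon>\<close> and is the identity unless \<open>\<phi> u\<close> lies between \<open>c - 2 * \<epsilon>\<close> and \<open>c - 0.5 * \<epsilon>\<close>
  (\<open>push_up_lower_band\<close>).  The same result for \<open>- \<phi>\<close> gives a map that lowers the upper part of the
  band.  Both maps fix \<open>D\<close>, and they never move the same point, so they combine to the map \<open>\<eta>\<close>.
\<close>

section \<open>The gradient on a Hilbert space\<close>

text \<open>
  The representing vector is the minimiser of \<open>\<lambda>x. (norm x)\<^sup>2 / 2 - f x\<close>.  By the parallelogram law
  a minimising sequence is Cauchy, so a minimiser exists; that the function does not decrease from
  there in the direction \<open>v\<close> gives the equation \<open>f v = x \<bullet> v\<close>.
\<close>

lemma riesz_representation:
  fixes f :: "'a::{real_inner, complete_space} \<Rightarrow> real"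
  assumes "bounded_linear f"
  shows "\<exists>x. \<forall>v. f v = x \<bullet> v"
proof -
  interpret f: bounded_linear f by fact
  define J where "J x = (norm x)\<^sup>2 / 2 - f x" for x
  obtain K where K: "\<And>x. norm (f x) \<le> norm x * K"
    using f.bounded by blast
  have lower: "- (K\<^sup>2 / 2) \<le> J x" for x
  proof -
    have "f x \<le> norm x * K" using K[of x] by simp
    moreover have "0 \<le> (norm x - K)\<^sup>2" by simp
    ultimately show ?thesis unfolding J_def power2_diff by (simp add: field_simps)
  qed
  define m where "m = Inf (range J)"
  have bdd: "bdd_below (range J)"
    using lower by (intro bdd_belowI2) blast
  have m_le: "m \<le> J x" for x
    unfolding m_def using bdd by (simp add: cInf_lower)
  have "\<exists>x. J x < m + inverse (real (Suc n))" for n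
    using cInf_lessD[of "range J" "m + inverse (real (Suc n))"] by (auto simp: m_def)
  then obtain y where y: "\<And>n. J (y n) < m + inverse (real (Suc n))" by metis
  have close: "(norm (a - b))\<^sup>2 / 4 \<le> J a + J b - 2 * m" for a b
  proof -
    have "J a + J b - 2 * J ((1/2) *\<^sub>R (a + b)) = (norm (a - b))\<^sup>2 / 4"
      unfolding J_def power2_norm_eq_inner
      by (simp add: f.scaleR f.add inner_simps inner_commute field_simps)
    then show ?thesis using m_le[of "(1/2) *\<^sub>R (a + b)"] by linarith
  qed
  have "Cauchy y"
  proof (rule metric_CauchyI)
    fix e :: real assume e: "0 < e"
    obtain N where N: "inverse (real (Suc N)) < e\<^sup>2 / 8"
      using reals_Archimedean[of "e\<^sup>2 / 8"] e by auto
    have "dist (y i) (y j) < e" if ij: "i \<ge> N" "j \<ge> N" for i j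
    proof -
      have "inverse (real (Suc i)) \<le> inverse (real (Suc N))" "inverse (real (Suc j)) \<le> inverse (real (Suc N))"
        using ij by (simp_all add: le_imp_inverse_le)
      then have "(norm (y i - y j))\<^sup>2 < e\<^sup>2"
        using close[of "y i" "y j"] y[of i] y[of j] N by linarith
      then show ?thesis
        using e by (simp add: dist_norm power2_less_imp_less)
    qed
    then show "\<exists>M. \<forall>i\<ge>M. \<forall>j\<ge>M. dist (y i) (y j) < e" by blast
  qed
  then obtain x where x: "y \<longlonglongrightarrow> x"
    using Cauchy_convergent_iff convergent_def by blast
  have "(\<lambda>n. J (y n)) \<longlonglongrightarrow> J x"
    unfolding J_def by (intro tendsto_intros f.tendsto x) simp
  moreover have "(\<lambda>n. m + inverse (real (Suc n))) \<longlonglongrightarrow> m + 0"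
    by (intro tendsto_intros LIMSEQ_inverse_real_of_nat)
  ultimately have "J x \<le> m"
    using y by (intro LIMSEQ_le[where X="\<lambda>n. J (y n)"]) (auto intro: less_imp_le)
  then have min: "J x \<le> J z" for z using m_le[of z] by linarith
  have "f v = x \<bullet> v" for v
  proof (cases "v = 0")
    case False
    \<comment> \<open>The value of \<open>t\<close> that minimises \<open>J (x + t *\<^sub>R v)\<close>.\<close>
    define t where "t = (f v - x \<bullet> v) / (v \<bullet> v)"
    have vv: "v \<bullet> v > 0" using False by simp
    have "J (x + t *\<^sub>R v) = J x - t * (f v - x \<bullet> v) + t * t * (v \<bullet> v) / 2"
      unfolding J_def power2_norm_eq_inner
      by (simp add: f.add f.scaleR inner_simps inner_commute field_simps)
    also have "\<dots> = J x - (f v - x \<bullet> v)\<^sup>2 / (2 * (v \<bullet> v))"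
      using vv by (simp add: t_def field_simps power2_eq_square)
    finally have "(f v - x \<bullet> v)\<^sup>2 / (2 * (v \<bullet> v)) \<le> 0" using min[of "x + t *\<^sub>R v"] by linarith
    then have "(f v - x \<bullet> v)\<^sup>2 \<le> 0"
      using vv by (simp add: divide_le_0_iff)
    then show ?thesis by simp
  qed (simp add: f.zero)
  then show ?thesis by blast
qed

text \<open>
  The Riesz isomorphism between the dual and the space is an isometry, so it transports both the
  continuity and the norm of the derivative to the gradient.
\<close>

lemma continuous_gradient:
  fixes \<phi> :: "'a::{real_inner, complete_space} \<Rightarrow> real"
  assumes diff: "\<And>u. \<phi> differentiable (at u)"
    and cont: "continuous_on UNIV (fderiv \<phi>)"
  obtains V where "continuous_on UNIV V" "\<And>u. (\<phi> has_derivative (\<lambda>x. V u \<bullet> x)) (at u)"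
    "\<And>u. norm (V u) = norm (fderiv \<phi> u)"
proof -
  obtain V where V: "\<And>u x. fderiv \<phi> u x = V u \<bullet> x"
    using riesz_representation[OF blinfun.bounded_linear_right[of "fderiv \<phi> _"]] by metis
  have le: "norm (V u - V v) \<le> norm (fderiv \<phi> u - fderiv \<phi> v)" for u v
  proof (cases "V u = V v")
    case False
    have "norm (V u - V v) * norm (V u - V v) = (fderiv \<phi> u - fderiv \<phi> v) (V u - V v)"
      by (simp add: blinfun.diff_left V flip: power2_eq_square)
         (simp add: power2_norm_eq_inner inner_diff_left)
    also have "\<dots> \<le> norm (fderiv \<phi> u - fderiv \<phi> v) * norm (V u - V v)"
      using norm_blinfun[of "fderiv \<phi> u - fderiv \<phi> v" "V u - V v"] by simp
    finally show ?thesis using False by simp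
  qed simp
  have "continuous_on UNIV V"
    unfolding continuous_on_iff
  proof (intro ballI allI impI)
    fix u :: 'a and e :: real assume "0 < e"
    then obtain d where "d > 0" "\<And>v. dist v u < d \<Longrightarrow> dist (fderiv \<phi> v) (fderiv \<phi> u) < e"
      using cont unfolding continuous_on_iff by (metis UNIV_I)
    then show "\<exists>d>0. \<forall>v\<in>UNIV. dist v u < d \<longrightarrow> dist (V v) (V u) < e"
      using le by (metis dist_norm le_less_trans)
  qed
  moreover have "(\<phi> has_derivative (\<lambda>x. V u \<bullet> x)) (at u)" for u
  proof -
    have "blinfun_apply (fderiv \<phi> u) = (\<lambda>x. V u \<bullet> x)" by (simp add: V fun_eq_iff)
    then show ?thesis using fderiv_has_derivative[OF diff, of u] by simp
  qed
  moreover have "norm (V u) = norm (fderiv \<phi> u)" for u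
  proof (rule antisym)
    show "norm (fderiv \<phi> u) \<le> norm (V u)"
      by (rule norm_blinfun_bound) (simp_all add: V Cauchy_Schwarz_ineq2)
    have "norm (V u) * norm (V u) \<le> norm (fderiv \<phi> u) * norm (V u)"
      using norm_blinfun[of "fderiv \<phi> u" "V u"]
      by (simp add: V dot_square_norm power2_eq_square)
    then show "norm (V u) \<le> norm (fderiv \<phi> u)"
      by (cases "V u = 0") simp_all
  qed
  ultimately show ?thesis by (rule that)
qed

section \<open>Discrete ascent along the gradient\<close>

text \<open>
  The step \<open>w u\<close> has to be so short that the gradient keeps at least half of its component along
  \<open>V u\<close> on the segment, and still depend continuously on \<open>u\<close>.  The pairs \<open>(u, v)\<close> for which \<open>v\<close>
  violates this form a closed set \<open>B\<close>, which contains \<open>(u, u)\<close> only if \<open>V u = 0\<close>.  The distance of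
  \<open>(u, u)\<close> from \<open>B\<close> is thus a continuous step bound, positive away from critical points.
\<close>

lemma ascent_step_field:
  fixes \<phi> :: "'a::real_inner \<Rightarrow> real"
  assumes cont: "continuous_on UNIV V"
    and deriv: "\<And>u. (\<phi> has_derivative (\<lambda>x. V u \<bullet> x)) (at u)"
  obtains w where "continuous_on UNIV w"
    "\<And>u s. 0 \<le> s \<Longrightarrow> s \<le> 1 \<Longrightarrow> \<phi> u + s * (norm (V u) * norm (w u) / 2) \<le> \<phi> (u + s *\<^sub>R w u)"
    "\<And>u. V u \<noteq> 0 \<Longrightarrow> w u \<noteq> 0"
proof -
  define B where "B = {p :: 'a \<times> 'a. V (snd p) \<bullet> V (fst p) \<le> (norm (V (fst p)))\<^sup>2 / 2}"
  \<comment> \<open>\<open>infdist\<close> to the empty set is \<open>0\<close>, although then any step is good.\<close>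
  define h where "h u = (if B = {} then 1 else infdist (u, u) B)" for u
  \<comment> \<open>With this factor the step \<open>w u\<close> is shorter than \<open>h u\<close>.\<close>
  define a where "a u = h u / (1 + norm (V u))" for u
  define w where "w u = a u *\<^sub>R V u" for u
  have contV: "continuous_on A (\<lambda>x. V (g x))" if "continuous_on A g" for A and g :: "'b::topological_space \<Rightarrow> 'a"
    using continuous_on_compose2[OF cont that] by simp
  have "closed B"
    unfolding B_def by (intro closed_Collect_le continuous_intros contV) auto
  have h_cont: "continuous_on UNIV h"
    unfolding h_def by (cases "B = {}") (auto intro!: continuous_intros)
  have h0: "h u \<ge> 0" for u by (simp add: h_def infdist_nonneg)
  have h_pos: "h u > 0" if "V u \<noteq> 0" for u
  proof -
    have "(u, u) \<notin> B" using that by (simp add: B_def power2_norm_eq_inner not_le)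
    then show ?thesis
      using \<open>closed B\<close> by (auto simp: h_def intro: infdist_pos_not_in_closed)
  qed
  have good: "(norm (V u))\<^sup>2 / 2 \<le> V v \<bullet> V u" if "dist u v < h u" for u v
  proof (rule ccontr)
    assume "\<not> ?thesis"
    then have "(u, v) \<in> B" by (simp add: B_def)
    then have "h u \<le> dist (u, u) (u, v)" by (auto simp: h_def intro: infdist_le)
    with that show False by (simp add: dist_Pair_Pair)
  qed
  have n1: "1 + norm (V u) > 0" for u
    using norm_ge_zero[of "V u"] by linarith
  have a0: "a u \<ge> 0" for u using h0[of u] n1[of u] by (simp add: a_def)
  have "continuous_on UNIV w"
    unfolding w_def a_def using n1
    by (intro continuous_intros h_cont contV) (auto simp: less_imp_neq[symmetric] order.strict_implies_not_eq)
  moreover have "\<phi> u + s * (norm (V u) * norm (w u) / 2) \<le> \<phi> (u + s *\<^sub>R w u)"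
    if s: "0 \<le> s" "s \<le> 1" for u s
  proof (cases "V u = 0")
    case False
    define C where "C = norm (V u) * norm (w u) / 2"
    have w_lt: "norm (w u) < h u"
    proof -
      have "h u * norm (V u) < h u * (1 + norm (V u))"
        using h_pos[OF False] by simp
      then show ?thesis
        using n1[of u] h0[of u] by (simp add: w_def a_def divide_less_eq)
    qed
    have d: "((\<lambda>t. \<phi> (u + t *\<^sub>R w u) - t * C) has_real_derivative V (u + t *\<^sub>R w u) \<bullet> w u - C) (at t)" for t
      unfolding has_field_derivative_def
      by (rule derivative_eq_intros has_derivative_compose[OF _ deriv, where f = "\<lambda>t. u + t *\<^sub>R w u"] refl)+
         (auto simp: fun_eq_iff algebra_simps inner_simps)
    have "(\<lambda>t. \<phi> (u + t *\<^sub>R w u) - t * C) 0 \<le> (\<lambda>t. \<phi> (u + t *\<^sub>R w u) - t * C) s"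
    proof (rule DERIV_nonneg_imp_nondecreasing[OF s(1)])
      fix t assume t: "0 \<le> t" "t \<le> s"
      have "norm (t *\<^sub>R w u) \<le> norm (w u)"
        using t s by (simp add: mult_left_le_one_le)
      then have "dist u (u + t *\<^sub>R w u) < h u"
        using w_lt by (simp add: dist_norm)
      from good[OF this] have "a u * ((norm (V u))\<^sup>2 / 2) \<le> a u * (V (u + t *\<^sub>R w u) \<bullet> V u)"
        by (rule mult_left_mono[OF _ a0])
      then have "C \<le> V (u + t *\<^sub>R w u) \<bullet> w u"
        using a0[of u] by (simp add: C_def w_def power2_eq_square mult_ac)
      then show "\<exists>y. ((\<lambda>t. \<phi> (u + t *\<^sub>R w u) - t * C) has_real_derivative y) (at t) \<and> 0 \<le> y"
        using d by (intro exI conjI) auto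
    qed
    then show ?thesis by (simp add: C_def)
  qed (simp add: w_def)
  moreover have "w u \<noteq> 0" if "V u \<noteq> 0" for u
    using h_pos[OF that] n1[of u] that by (simp add: w_def a_def)
  ultimately show ?thesis by (rule that)
qed

text \<open>
  While the orbit stays in the band, \<open>slope\<close> telescopes: the distance between two points of the
  orbit is at most \<open>K\<close> times the difference of their values.  The values converge, being increasing
  and bounded, so the orbit would converge too, and by continuity of \<open>T\<close> its limit would be a fixed
  point in the band.
\<close>

lemma orbit_leaves_band:
  fixes T :: "'a::complete_space \<Rightarrow> 'a" and \<phi> :: "'a \<Rightarrow> real"
  assumes T: "continuous_on UNIV T" and \<phi>: "continuous_on UNIV \<phi>"
    and ascent: "\<And>u. \<phi> u \<le> \<phi> (T u)"
    and slope: "\<And>u. \<alpha> \<le> \<phi> u \<Longrightarrow> \<phi> u \<le> \<beta> \<Longrightarrow> dist u (T u) \<le> K * (\<phi> (T u) - \<phi> u)"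
    and no_fixpoint: "\<And>u. \<alpha> \<le> \<phi> u \<Longrightarrow> \<phi> u \<le> \<beta> \<Longrightarrow> T u \<noteq> u"
    and Kpos: "0 \<le> K"
    and start: "\<alpha> \<le> \<phi> u"
  shows "\<exists>k. \<beta> < \<phi> ((T ^^ k) u)"
proof (rule ccontr)
  assume stays: "\<not> ?thesis"
  define x where "x k = (T ^^ k) u" for k
  have x_Suc: "x (Suc k) = T (x k)" for k by (simp add: x_def)
  have hi: "\<phi> (x k) \<le> \<beta>" for k
    using stays by (auto simp: x_def not_less)
  have inc: "incseq (\<lambda>k. \<phi> (x k))"
    by (rule incseq_SucI) (simp add: x_Suc ascent)
  have lo: "\<alpha> \<le> \<phi> (x k)" for k
    using incseqD[OF inc, of 0 k] start by (simp add: x_def)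
  have dist_le: "dist (x i) (x j) \<le> K * (\<phi> (x j) - \<phi> (x i))" if "i \<le> j" for i j
    using that
  proof (induction rule: dec_induct)
    case (step n)
    have "dist (x i) (x (Suc n)) \<le> dist (x i) (x n) + dist (x n) (x (Suc n))"
      by (rule dist_triangle)
    then show ?case
      using step.IH slope[OF lo hi, of n] by (simp add: x_Suc algebra_simps)
  qed simp
  obtain l where "(\<lambda>k. \<phi> (x k)) \<longlonglongrightarrow> l"
    using incseq_convergent[OF inc, of \<beta>] hi by blast
  then have C\<phi>: "Cauchy (\<lambda>k. \<phi> (x k))"
    by (rule LIMSEQ_imp_Cauchy)
  have "Cauchy x"
  proof (rule metric_CauchyI)
    fix e :: real assume e: "0 < e"
    obtain M where M: "\<And>i j. i \<ge> M \<Longrightarrow> j \<ge> M \<Longrightarrow> dist (\<phi> (x i)) (\<phi> (x j)) < e / (K + 1)"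
      using metric_CauchyD[OF C\<phi>, of "e / (K + 1)"] e Kpos by auto
    have small: "dist (x i) (x j) < e" if "M \<le> i" "i \<le> j" for i j
    proof -
      have "\<phi> (x j) - \<phi> (x i) < e / (K + 1)"
        using M[of i j] that by (simp add: dist_real_def)
      moreover have "0 \<le> \<phi> (x j) - \<phi> (x i)" using incseqD[OF inc that(2)] by simp
      ultimately have "(K + 1) * (\<phi> (x j) - \<phi> (x i)) < e"
        using Kpos by (simp add: field_simps)
      then show ?thesis
        using dist_le[OF that(2)] \<open>0 \<le> \<phi> (x j) - \<phi> (x i)\<close> by (simp add: algebra_simps)
    qed
    have "dist (x i) (x j) < e" if "i \<ge> M" "j \<ge> M" for i j
      using small[of i j] small[of j i] that by (cases "i \<le> j") (auto simp: dist_commute)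
    then show "\<exists>M. \<forall>i\<ge>M. \<forall>j\<ge>M. dist (x i) (x j) < e" by blast
  qed
  then obtain y where y: "x \<longlonglongrightarrow> y"
    using Cauchy_convergent_iff convergent_def by blast
  have "(\<lambda>k. \<phi> (x k)) \<longlonglongrightarrow> \<phi> y" "(\<lambda>k. T (x k)) \<longlonglongrightarrow> T y"
    using y T \<phi> by (auto intro: continuous_on_tendsto_compose)
  then have "\<alpha> \<le> \<phi> y" "\<phi> y \<le> \<beta>"
    using lo hi by (auto intro: LIMSEQ_le_const LIMSEQ_le_const2)
  moreover have "T y = y"
    using \<open>(\<lambda>k. T (x k)) \<longlonglongrightarrow> T y\<close> LIMSEQ_Suc[OF y] by (simp add: x_Suc LIMSEQ_unique)
  ultimately show False using no_fixpoint by blast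
qed

section \<open>Continuously many steps\<close>

text \<open>
  The first index \<open>k\<close> with \<open>0 < f k u\<close> is locally bounded but not continuous in \<open>u\<close>.  A continuous
  bound for it comes from the sum \<open>g u\<close> of the positive parts of \<open>f k u\<close>, truncated and weighted with
  \<open>(1/2) ^ k\<close>: if the first \<open>N + 1\<close> of them vanish, then \<open>g u \<le> (1/2) ^ N\<close>, so
  \<open>1 / g u \<ge> 2 ^ N \<ge> N + 1\<close>.  Hence some index up to \<open>1 / g u\<close> has a positive value.
\<close>

lemma continuous_index_bound:
  fixes f :: "nat \<Rightarrow> 'a::topological_space \<Rightarrow> real"
  assumes cont: "\<And>k. continuous_on UNIV (f k)"
    and ex: "\<And>u. \<exists>k. 0 < f k u"
  obtains n where "continuous_on UNIV n" "\<And>u. \<exists>k. real k \<le> n u \<and> 0 < f k u"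
proof -
  define F where "F k u = (1/2) ^ k * min 1 (max 0 (f k u))" for k u
  define g where "g u = (\<Sum>k. F k u)" for u
  have F0: "0 \<le> F k u" and F1: "F k u \<le> (1/2) ^ k" for k u
    by (auto simp: F_def mult_left_le)
  have summ: "summable (\<lambda>k. F k u)" for u
    by (rule summable_comparison_test'[of "\<lambda>k. (1/2)^k" 0]) (use F0 F1 in \<open>auto simp: summable_geometric\<close>)
  have "uniform_limit UNIV (\<lambda>n u. \<Sum>k<n. F k u) g sequentially"
    unfolding g_def
    by (rule Weierstrass_m_test[of _ _ "\<lambda>k. (1/2)^k"]) (use F0 F1 in \<open>auto simp: summable_geometric\<close>)
  then have g_cont: "continuous_on UNIV g"
    by (rule uniform_limit_theorem[rotated])
       (auto simp: F_def intro!: always_eventually continuous_intros cont)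
  have g_pos: "g u > 0" for u
  proof -
    obtain k where "0 < f k u" using ex by blast
    then have "0 < F k u" by (simp add: F_def)
    then show ?thesis unfolding g_def using summ F0 by (intro suminf_pos2)
  qed
  show ?thesis
  proof (rule that[of "\<lambda>u. 1 / g u"])
    show "continuous_on UNIV (\<lambda>u. 1 / g u)"
      using g_pos by (intro continuous_intros g_cont) (auto simp: less_imp_neq[symmetric] order.strict_implies_not_eq)
    fix u
    show "\<exists>k. real k \<le> 1 / g u \<and> 0 < f k u"
    proof (rule ccontr)
      assume none: "\<not> ?thesis"
      define N where "N = nat \<lfloor>1 / g u\<rfloor>"
      have N: "real N \<le> 1 / g u" "1 / g u < real N + 1"
        unfolding N_def using g_pos[of u] by (simp_all add: less_imp_le)
      have head: "F k u = 0" if "k < Suc N" for k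
      proof -
        have "real k \<le> 1 / g u" using that N(1) by (simp add: less_Suc_eq_le order_trans[of _ "real N"])
        then have "f k u \<le> 0" using none by (auto simp: not_less)
        then show ?thesis by (simp add: F_def)
      qed
      have tail: "(\<lambda>k. (1/2 :: real) ^ (k + Suc N)) sums (1/2) ^ N"
        using sums_mult2[OF power_half_series, of "(1/2) ^ N"] by (simp add: power_add mult_ac)
      have "g u = (\<Sum>k. F (k + Suc N) u)"
        using suminf_split_initial_segment[OF summ, of u "Suc N"] head by (simp add: g_def)
      also have "\<dots> \<le> (\<Sum>k. (1/2) ^ (k + Suc N))"
        by (rule suminf_le[OF F1]) (use summ tail in \<open>auto simp: sums_iff simp del: add_Suc_right intro: summable_ignore_initial_segment\<close>)
      also have "\<dots> = (1/2) ^ N"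
        using tail by (simp add: sums_iff)
      finally have "g u \<le> (1/2) ^ N" .
      then have "2 ^ N \<le> 1 / g u"
        using g_pos[of u] by (simp add: field_simps power_one_over)
      moreover have "real N + 1 \<le> 2 ^ N"
        by (metis Suc_leI add.commute less_exp of_nat_Suc of_nat_le_iff of_nat_numeral of_nat_power)
      ultimately show False using N(2) by linarith
    qed
  qed
qed

text \<open>
  Step number \<open>k\<close> is scaled by \<open>m u - k\<close>, clipped to the interval from \<open>0\<close> to \<open>1\<close>: the first
  \<open>\<lfloor>m u\<rfloor>\<close> steps are complete, the next one is partial, and all later ones do nothing.  After
  \<open>K\<close> steps the result is continuous in \<open>u\<close>, and for \<open>m u \<le> K\<close> it is already final; so the final
  result agrees locally with a continuous function.  Partial steps do not lose height, hence it
  is at least as high as after \<open>k\<close> complete steps, for any \<open>k \<le> m u\<close>.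
\<close>

lemma variable_number_of_steps:
  fixes w :: "'a::real_normed_vector \<Rightarrow> 'a" and \<phi> m :: "'a \<Rightarrow> real"
  assumes w: "continuous_on UNIV w" and m: "continuous_on UNIV m"
    and ascent: "\<And>u s. 0 \<le> s \<Longrightarrow> s \<le> 1 \<Longrightarrow> \<phi> u \<le> \<phi> (u + s *\<^sub>R w u)"
  obtains \<eta> where "continuous_on UNIV \<eta>" "\<And>u. m u \<le> 0 \<Longrightarrow> \<eta> u = u"
    "\<And>u k. real k \<le> m u \<Longrightarrow> \<phi> (((\<lambda>u. u + w u) ^^ k) u) \<le> \<phi> (\<eta> u)"
proof -
  define clip :: "real \<Rightarrow> real" where "clip t = max 0 (min 1 t)" for t
  define E where "E = rec_nat (\<lambda>u. u) (\<lambda>k Ek u. Ek u + clip (m u - real k) *\<^sub>R w (Ek u))"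
  have E0: "E 0 u = u" and ES: "E (Suc k) u = E k u + clip (m u - real k) *\<^sub>R w (E k u)" for k u
    by (simp_all add: E_def)
  have E_cont: "continuous_on UNIV (E k)" for k
  proof (induction k)
    case 0
    have "E 0 = (\<lambda>u. u)" by (simp add: E0 fun_eq_iff)
    then show ?case by simp
  next
    case (Suc k)
    have "E (Suc k) = (\<lambda>u. E k u + clip (m u - real k) *\<^sub>R w (E k u))"
      by (simp add: ES fun_eq_iff)
    then show ?case
      unfolding clip_def
      using Suc m continuous_on_compose2[OF w Suc] by (auto intro!: continuous_intros)
  qed
  have E_stable: "E (k + j) u = E k u" if "m u \<le> real k" for k j u
    using that by (induction j) (auto simp: ES clip_def)
  have E_iter: "E k u = ((\<lambda>u. u + w u) ^^ k) u" if "real k \<le> m u" for k u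
    using that by (induction k) (auto simp: E0 ES clip_def)
  have E_mono: "\<phi> (E k u) \<le> \<phi> (E (k + j) u)" for k j u
  proof (induction j)
    case (Suc j)
    have "\<phi> (E (k + j) u) \<le> \<phi> (E (Suc (k + j)) u)"
      unfolding ES by (rule ascent) (auto simp: clip_def)
    with Suc show ?case by simp
  qed simp
  define \<eta> where "\<eta> u = E (nat \<lceil>m u\<rceil>) u" for u
  have \<eta>_eq: "\<eta> u = E K u" if "m u \<le> real K" for u K
  proof -
    have "nat \<lceil>m u\<rceil> \<le> K" using that by (simp add: ceiling_le_iff nat_le_iff)
    moreover have "m u \<le> real (nat \<lceil>m u\<rceil>)" by linarith
    ultimately show ?thesis
      unfolding \<eta>_def using E_stable[of u "nat \<lceil>m u\<rceil>" "K - nat \<lceil>m u\<rceil>"] by simp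
  qed
  show ?thesis
  proof (rule that)
    show "continuous_on UNIV \<eta>"
    proof (rule continuous_at_imp_continuous_on, rule ballI)
      fix u
      obtain K :: nat where K: "m u < real K" using reals_Archimedean2 by blast
      have "open {v. m v < real K}"
        using m by (intro open_Collect_less continuous_intros)
      moreover have "continuous_on {v. m v < real K} \<eta>"
        using continuous_on_subset[OF E_cont[of K] subset_UNIV]
        by (rule continuous_on_eq) (simp add: \<eta>_eq[where K = K] less_imp_le)
      ultimately show "isCont \<eta> u"
        using K by (simp add: continuous_on_eq_continuous_at)
    qed
    show "\<eta> u = u" if "m u \<le> 0" for u
      using \<eta>_eq[of u 0] that by (simp add: E0)
    show "\<phi> (((\<lambda>u. u + w u) ^^ k) u) \<le> \<phi> (\<eta> u)" if "real k \<le> m u" for u k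
    proof -
      have "k \<le> nat \<lceil>m u\<rceil>" using that by linarith
      then show ?thesis
        using E_mono[of k u "nat \<lceil>m u\<rceil> - k"] E_iter[OF that] by (simp add: \<eta>_def)
    qed
  qed
qed

section \<open>Moving points across the band\<close>

text \<open>
  The number of steps is \<open>\<kappa> u * n u\<close>, where \<open>n u\<close> bounds the time at which the orbit of \<open>u\<close> exceeds
  \<open>\<beta>\<close>.
\<close>

lemma push_above_level:
  fixes \<phi> \<kappa> :: "'a::{real_inner, complete_space} \<Rightarrow> real"
  assumes V: "continuous_on UNIV V"
    and deriv: "\<And>u. (\<phi> has_derivative (\<lambda>x. V u \<bullet> x)) (at u)"
    and \<delta>: "0 < \<delta>" "\<And>u. \<alpha> \<le> \<phi> u \<Longrightarrow> \<phi> u \<le> \<beta> \<Longrightarrow> \<delta> \<le> norm (V u)"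
    and \<kappa>: "continuous_on UNIV \<kappa>"
  obtains \<eta> where "continuous_on UNIV \<eta>" "\<And>u. \<kappa> u = 0 \<Longrightarrow> \<eta> u = u"
    "\<And>u. \<kappa> u = 1 \<Longrightarrow> \<alpha> \<le> \<phi> u \<Longrightarrow> \<beta> \<le> \<phi> (\<eta> u)"
proof -
  obtain w where w: "continuous_on UNIV w"
    and gain: "\<And>u s. 0 \<le> s \<Longrightarrow> s \<le> 1 \<Longrightarrow> \<phi> u + s * (norm (V u) * norm (w u) / 2) \<le> \<phi> (u + s *\<^sub>R w u)"
    and w0: "\<And>u. V u \<noteq> 0 \<Longrightarrow> w u \<noteq> 0"
    using ascent_step_field[OF V deriv] by blast
  have ascent: "\<phi> u \<le> \<phi> (u + s *\<^sub>R w u)" if "0 \<le> s" "s \<le> 1" for u s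
  proof -
    have "0 \<le> s * (norm (V u) * norm (w u) / 2)" using that by simp
    then show ?thesis using gain[OF that, of u] by linarith
  qed
  have \<phi>: "continuous_on UNIV \<phi>"
    using deriv has_derivative_continuous by (blast intro: continuous_at_imp_continuous_on)
  define T where "T = (\<lambda>u. u + w u)"
  have T: "continuous_on UNIV T"
    unfolding T_def by (intro continuous_intros w)
  have exit: "\<exists>k. \<beta> < \<phi> ((T ^^ k) u)" if "\<alpha> \<le> \<phi> u" for u
  proof (rule orbit_leaves_band[OF T \<phi>, where K = "2 / \<delta>", OF _ _ _ _ that])
    show "0 \<le> 2 / \<delta>" using \<delta>(1) by simp
    show "\<phi> v \<le> \<phi> (T v)" for v using ascent[of 1 v] by (simp add: T_def)
    fix v assume v: "\<alpha> \<le> \<phi> v" "\<phi> v \<le> \<beta>"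
    have "\<delta> * norm (w v) \<le> norm (V v) * norm (w v)"
      using \<delta>(2)[OF v] by (rule mult_right_mono) simp
    then have "\<delta> * norm (w v) \<le> 2 * (\<phi> (T v) - \<phi> v)"
      using gain[of 1 v] by (simp add: T_def)
    then show "dist v (T v) \<le> 2 / \<delta> * (\<phi> (T v) - \<phi> v)"
      using \<delta>(1) by (simp add: T_def dist_norm field_simps)
    have "V v \<noteq> 0" using \<delta>(1) \<delta>(2)[OF v] by auto
    then show "T v \<noteq> v" using w0 by (simp add: T_def)
  qed
  have iter: "continuous_on UNIV (T ^^ k)" for k
  proof (induction k)
    case (Suc k)
    then show ?case using continuous_on_compose2[OF T Suc] by (simp add: o_def)
  qed (simp add: id_def)
  \<comment> \<open>Orbits that start below \<open>\<alpha>\<close> need not rise above \<open>\<beta>\<close>; the second argument of \<open>max\<close> makes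
    every index acceptable for them, so that \<open>n\<close> is defined on the whole space.\<close>
  define f where "f k u = max (\<phi> ((T ^^ k) u) - \<beta>) (\<alpha> - \<phi> u)" for k u
  have "continuous_on UNIV (f k)" for k
    unfolding f_def by (intro continuous_intros \<phi> continuous_on_compose2[OF \<phi> iter]) simp
  moreover have "\<exists>k. 0 < f k u" for u
    using exit[of u] by (cases "\<alpha> \<le> \<phi> u") (auto simp: f_def less_max_iff_disj)
  ultimately obtain n where n: "continuous_on UNIV n" "\<And>u. \<exists>k. real k \<le> n u \<and> 0 < f k u"
    using continuous_index_bound[of f] by metis
  obtain \<eta> where \<eta>: "continuous_on UNIV \<eta>" "\<And>u. \<kappa> u * n u \<le> 0 \<Longrightarrow> \<eta> u = u"
    "\<And>u k. real k \<le> \<kappa> u * n u \<Longrightarrow> \<phi> ((T ^^ k) u) \<le> \<phi> (\<eta> u)"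
    using variable_number_of_steps[OF w continuous_on_mult[OF \<kappa> n(1)] ascent]
    unfolding T_def by metis
  show ?thesis
  proof (rule that[OF \<eta>(1)])
    show "\<eta> u = u" if "\<kappa> u = 0" for u using \<eta>(2) that by simp
    fix u assume u: "\<kappa> u = 1" "\<alpha> \<le> \<phi> u"
    obtain k where "real k \<le> n u" "0 < f k u" using n(2) by blast
    then show "\<beta> \<le> \<phi> (\<eta> u)"
      using \<eta>(3)[of k u] u by (simp add: f_def less_max_iff_disj)
  qed
qed

text \<open>
  The cut-off is a trapezoidal function \<open>\<theta>\<close> of the value \<open>\<phi> u\<close>.  It rises from \<open>0\<close> at \<open>c - 2 * \<epsilon>\<close>
  to \<open>1\<close> at \<open>c - \<epsilon>\<close> and falls from \<open>1\<close> at \<open>c - 0.6 * \<epsilon>\<close> to \<open>0\<close> at \<open>c - 0.5 * \<epsilon>\<close>; the factor \<open>10\<close> is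
  the slope of the short side.
\<close>

lemma push_up_lower_band:
  fixes \<phi> :: "'a::{real_inner, complete_space} \<Rightarrow> real"
  assumes V: "continuous_on UNIV V"
    and deriv: "\<And>u. (\<phi> has_derivative (\<lambda>x. V u \<bullet> x)) (at u)"
    and \<epsilon>: "0 < \<epsilon>"
    and V_ge: "\<And>u. c - 2 * \<epsilon> \<le> \<phi> u \<Longrightarrow> \<phi> u \<le> c + 2 * \<epsilon> \<Longrightarrow> 2 * \<epsilon> \<le> norm (V u)"
  obtains \<eta> where "continuous_on UNIV \<eta>"
    "\<And>u. \<phi> u \<le> c - 2 * \<epsilon> \<or> c - 0.5 * \<epsilon> \<le> \<phi> u \<Longrightarrow> \<eta> u = u"
    "\<And>u. c - \<epsilon> \<le> \<phi> u \<Longrightarrow> \<phi> u \<le> c - 0.6 * \<epsilon> \<Longrightarrow> c + \<epsilon> \<le> \<phi> (\<eta> u)"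
proof -
  define \<theta> where "\<theta> t = max 0 (min 1 (min ((t - (c - 2 * \<epsilon>)) / \<epsilon>) (10 * (c - 0.5 * \<epsilon> - t) / \<epsilon>)))" for t
  have \<phi>: "continuous_on UNIV \<phi>"
    using deriv has_derivative_continuous by (blast intro: continuous_at_imp_continuous_on)
  have "continuous_on UNIV (\<lambda>u. \<theta> (\<phi> u))"
    unfolding \<theta>_def using \<epsilon> by (intro continuous_intros \<phi>) auto
  moreover have "2 * \<epsilon> \<le> norm (V u)" if "c - \<epsilon> \<le> \<phi> u" "\<phi> u \<le> c + \<epsilon>" for u
    using V_ge[of u] that \<epsilon> by simp
  ultimately obtain \<eta> where \<eta>: "continuous_on UNIV \<eta>" "\<And>u. \<theta> (\<phi> u) = 0 \<Longrightarrow> \<eta> u = u"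
    "\<And>u. \<theta> (\<phi> u) = 1 \<Longrightarrow> c - \<epsilon> \<le> \<phi> u \<Longrightarrow> c + \<epsilon> \<le> \<phi> (\<eta> u)"
    using push_above_level[OF V deriv, of "2 * \<epsilon>" "c - \<epsilon>" "c + \<epsilon>" "\<lambda>u. \<theta> (\<phi> u)"] \<epsilon> by auto
  show ?thesis
  proof (rule that[OF \<eta>(1)])
    fix u assume "\<phi> u \<le> c - 2 * \<epsilon> \<or> c - 0.5 * \<epsilon> \<le> \<phi> u"
    then have "(\<phi> u - (c - 2 * \<epsilon>)) / \<epsilon> \<le> 0 \<or> 10 * (c - 0.5 * \<epsilon> - \<phi> u) / \<epsilon> \<le> 0"
      using \<epsilon> by (auto simp: divide_le_0_iff)
    then have "\<theta> (\<phi> u) = 0" unfolding \<theta>_def by auto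
    then show "\<eta> u = u" by (rule \<eta>(2))
  next
    fix u assume u: "c - \<epsilon> \<le> \<phi> u" "\<phi> u \<le> c - 0.6 * \<epsilon>"
    then have "1 \<le> (\<phi> u - (c - 2 * \<epsilon>)) / \<epsilon>" "1 \<le> 10 * (c - 0.5 * \<epsilon> - \<phi> u) / \<epsilon>"
      using \<epsilon> by (simp_all add: le_divide_eq)
    then have "\<theta> (\<phi> u) = 1" unfolding \<theta>_def by auto
    then show "c + \<epsilon> \<le> \<phi> (\<eta> u)" using u(1) by (rule \<eta>(3))
  qed
qed

section \<open>Exchanging the two sides of the band\<close>

theorem theorem3p1:
  fixes \<phi> :: "'a::{real_inner, complete_space} \<Rightarrow> real"
    and c \<epsilon> :: real
    and D :: "'a set"
  assumes "C2 \<phi>"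
    and "\<epsilon> > 0"
    and "\<forall>u \<in> \<phi> -` {c - 2 * \<epsilon> .. c + 2 * \<epsilon>}. norm (fderiv \<phi> u) \<ge> 2 * \<epsilon>"
    and "D \<subseteq> \<phi> -` {c - 0.5 * \<epsilon> .. c + 0.5 * \<epsilon>}"
  shows "\<exists>\<eta> :: 'a \<Rightarrow> 'a. continuous_on UNIV \<eta> \<and>
    (\<forall>u. u \<notin> \<phi> -` {c - 2 * \<epsilon> .. c + 2 * \<epsilon>} - D \<longrightarrow> \<eta> u = u) \<and>
    \<eta> ` (\<phi> -` {c - \<epsilon> .. c - 0.6 * \<epsilon>}) \<subseteq> \<phi> -` {c + \<epsilon> ..} \<and>
    \<eta> ` (\<phi> -` {c + 0.6 * \<epsilon> .. c + \<epsilon>}) \<subseteq> \<phi> -` {.. c - \<epsilon>}"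
proof -
  have "\<phi> differentiable (at u)" for u
    using assms(1) by (simp add: C2_def differentiable_on_def)
  moreover have "continuous_on UNIV (fderiv \<phi>)"
    using assms(1) by (auto simp: C2_def intro: differentiable_imp_continuous_on)
  ultimately obtain V where V: "continuous_on UNIV V"
    and deriv: "\<And>u. (\<phi> has_derivative (\<lambda>x. V u \<bullet> x)) (at u)"
    and norm_V: "\<And>u. norm (V u) = norm (fderiv \<phi> u)"
    using continuous_gradient by metis
  have V_ge: "2 * \<epsilon> \<le> norm (V u)" if "c - 2 * \<epsilon> \<le> \<phi> u" "\<phi> u \<le> c + 2 * \<epsilon>" for u
    using assms(3) that by (simp add: norm_V)
  obtain \<eta>1 where \<eta>1: "continuous_on UNIV \<eta>1"
    "\<And>u. \<phi> u \<le> c - 2 * \<epsilon> \<or> c - 0.5 * \<epsilon> \<le> \<phi> u \<Longrightarrow> \<eta>1 u = u"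
    "\<And>u. c - \<epsilon> \<le> \<phi> u \<Longrightarrow> \<phi> u \<le> c - 0.6 * \<epsilon> \<Longrightarrow> c + \<epsilon> \<le> \<phi> (\<eta>1 u)"
    using push_up_lower_band[OF V deriv \<open>\<epsilon> > 0\<close> V_ge] by blast
  have V': "continuous_on UNIV (\<lambda>u. - V u)" by (intro continuous_intros V)
  have deriv': "((\<lambda>u. - \<phi> u) has_derivative (\<lambda>x. - V u \<bullet> x)) (at u)" for u
    using has_derivative_minus[OF deriv] by simp
  obtain \<eta>2 where \<eta>2: "continuous_on UNIV \<eta>2"
    "\<And>u. - \<phi> u \<le> - c - 2 * \<epsilon> \<or> - c - 0.5 * \<epsilon> \<le> - \<phi> u \<Longrightarrow> \<eta>2 u = u"
    "\<And>u. - c - \<epsilon> \<le> - \<phi> u \<Longrightarrow> - \<phi> u \<le> - c - 0.6 * \<epsilon> \<Longrightarrow> - c + \<epsilon> \<le> - \<phi> (\<eta>2 u)"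
    by (rule push_up_lower_band[OF V' deriv' \<open>\<epsilon> > 0\<close>, of "- c"]) (use V_ge in force, blast)
  \<comment> \<open>At every point at least one of \<open>\<eta>1\<close> and \<open>\<eta>2\<close> is the identity, and \<open>\<eta>\<close> agrees with the other.\<close>
  define \<eta> where "\<eta> u = \<eta>1 u + \<eta>2 u - u" for u
  have "continuous_on UNIV \<eta>"
    unfolding \<eta>_def by (intro continuous_intros \<eta>1(1) \<eta>2(1))
  moreover have "\<eta> u = u" if "u \<notin> \<phi> -` {c - 2 * \<epsilon> .. c + 2 * \<epsilon>} - D" for u
  proof -
    have "\<phi> u < c - 2 * \<epsilon> \<or> c + 2 * \<epsilon> < \<phi> u \<or> (c - 0.5 * \<epsilon> \<le> \<phi> u \<and> \<phi> u \<le> c + 0.5 * \<epsilon>)"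
      using that assms(4) by auto
    then have "\<eta>1 u = u" "\<eta>2 u = u"
      using \<open>\<epsilon> > 0\<close> by (auto intro!: \<eta>1(2) \<eta>2(2))
    then show ?thesis by (simp add: \<eta>_def)
  qed
  moreover have "c + \<epsilon> \<le> \<phi> (\<eta> u)" if "c - \<epsilon> \<le> \<phi> u" "\<phi> u \<le> c - 0.6 * \<epsilon>" for u
  proof -
    have "\<eta>2 u = u" using that \<open>\<epsilon> > 0\<close> by (intro \<eta>2(2)) simp
    then show ?thesis using \<eta>1(3)[OF that] by (simp add: \<eta>_def)
  qed
  moreover have "\<phi> (\<eta> u) \<le> c - \<epsilon>" if "c + 0.6 * \<epsilon> \<le> \<phi> u" "\<phi> u \<le> c + \<epsilon>" for u
  proof -
    have "\<eta>1 u = u" using that \<open>\<epsilon> > 0\<close> by (intro \<eta>1(2)) simp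
    then show ?thesis using \<eta>2(3)[of u] that by (simp add: \<eta>_def)
  qed
  ultimately show ?thesis
    by (intro exI[of _ \<eta>]) auto
qed

end
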